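(* Let $R$ be a commutative Frobenius ring with unity and with a fixed non-trivial involutory ring automorphism $x\mapsto\overline{x}$. Let $k,n\in\mathbb{N}$, let $\lambda,\mu\in R$ satisfy $\lambda\overline{\lambda}=\mu\overline{\mu}=1$, let $\mathbf{a}_0,\dots,\mathbf{a}_{k-1}\in R^n$ and $A_i=\mathrm{circ}_\mu(\mathbf{a}_i)$. Let $$G=\begin{pmatrix} I_{kn} & X\end{pmatrix},\qquad X=\mathrm{circ}_\lambda(A_0,A_1,\dots,A_{k-1}).$$ Then $G$ is a generator matrix of a Hermitian self-dual $[2kn,kn]$-code over $R$ if and only if all of the following hold: (i) $\sum_{i=0}^{k-1}\Theta(\mathbf{a}_i,\overline{\mathbf{a}_i},t)[\overline{\mu}]=-1$ for $t=0$ and $=0$ for $t\in\{1,\dots,\lfloor n/2\rfloor\}$; (ii) for every $j\in\{1,\dots,\lfloor k/2\rfloor\}$: $\sum_{i=0}^{k-j-1}\Theta(\mathbf{a}_{[i+j]_k},\overline{\mathbf{a}_i},0)+\overline{\lambda}\sum_{i=k-j}^{k-1}\Theta(\mathbf{a}_{[i+j]_k},\overline{\mathbf{a}_i},0)=0$; (iii) for every $j\in\{1,\dots,k-1\}$ and $t\in\{1,\dots,\lfloor n/2\rfloor\}$: $\sum_{i=0}^{k-j-1}\Theta(\mathbf{a}_{[i+j]_k},\overline{\mathbf{a}_i},t)[\overline{\mu}]+\overline{\lambda}\sum_{i=k-j}^{k-1}\Theta(\mathbf{a}_{[i+j]_k},\overline{\mathbf{a}_i},t)[\overline{\mu}]=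0$.
   Context: For a vector or matrix over $R$, the bar denotes entrywise application of the involution. For $\nu\in R$ and $\mathbf{v}=(v_0,\dots,v_{n-1})\in R^n$, $\mathrm{circ}_\nu(\mathbf{v})$ is the $n\times n$ $\nu$-circulant matrix whose first row is $\mathbf{v}$ and each subsequent row is the previous row shifted cyclically one place to the right, with the entry wrapped around to the first position multiplied by $\nu$. Similarly $\mathrm{circ}_\lambda(A_0,\dots,A_{k-1})$ is the $kn\times kn$ block matrix whose first block row is $(A_0,\dots,A_{k-1})$ and each subsequent block row is the previous one shifted cyclically one block to the right, with the block wrapped around to the first position multiplied by $\lambda$. $[m]_N\in\{0,\dots,N-1\}$ denotes the residue of $m$ modulo $N$. For $\mathbf{x}=(x_0,\dots,x_{n-1}),\mathbf{y}=(y_0,\dots,y_{n-1})\in R^n$, $j\in\{0,\dots,n-1\}$ and $\nu\in R$: $\Theta(\mathbf{x},\mathbf{y},j)[\nu]=\sum_{i=0}^{n-j-1}x_{[i+j]_n}y_i+\nu\sum_{i=n-j}^{n-1}x_{[i+j]_n}y_i$; $\Theta(\mathbf{x},\mathbf{y},0)=\sum_i x_iy_i$ (independent of $\nu$). The Hermitian inner product on $R^N$ is $\langle\mathbf{x},\mathbf{y}\rangle_H=\sum_i x_i\overline{y_i}$; a code (the $R$-submodule generated by the rows of $G$) is Hermitian self-dual if it equals its Hermitian dual $\{\mathbf{x}:\langle\mathbf{x},\mathbf{y}\rangle_H=0\ \forall\mathbf{y}\in\mathcal{C}\}$. *)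

theory Defs
  imports "Jordan_Normal_Form.VS_Connect" "HOL-Algebra.QuotRing"
begin

section \<open>Commutative Frobenius rings\<close>

definition artinian_cring :: "('a, 'b) ring_scheme \<Rightarrow> bool" where
  "artinian_cring R \<longleftrightarrow> cring R \<and>
     (\<forall>I :: nat \<Rightarrow> 'a set. (\<forall>m. ideal (I m) R \<and> I (Suc m) \<subseteq> I m) \<longrightarrow> (\<exists>m. \<forall>l\<ge>m. I l = I m))"

definition jacobson_radical :: "('a, 'b) ring_scheme \<Rightarrow> 'a set" where
  "jacobson_radical R = carrier R \<inter> \<Inter> {M. maximalideal M R}"

definition minimal_ideal :: "'a set \<Rightarrow> ('a, 'b) ring_scheme \<Rightarrow> bool" where
  "minimal_ideal I R \<longleftrightarrow> ideal I R \<and> I \<noteq> {\<zero>\<^bsub>R\<^esub>} \<and>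
     (\<forall>J. ideal J R \<and> J \<subseteq> I \<longrightarrow> J = {\<zero>\<^bsub>R\<^esub>} \<or> J = I)"

definition socle :: "('a, 'b) ring_scheme \<Rightarrow> 'a set" where
  "socle R = genideal R (\<Union> {I. minimal_ideal I R})"

text \<open>An ideal, and the quotient by an ideal, as modules over the ring. The \<open>mult\<close> and \<open>one\<close>
  fields of the module record play no role.\<close>

definition ideal_module :: "('a, 'b) ring_scheme \<Rightarrow> 'a set \<Rightarrow> ('a, 'a) module" where
  "ideal_module R I =
     \<lparr>carrier = I, mult = mult R, one = one R, zero = zero R, add = add R, smult = mult R\<rparr>"

definition quotient_module :: "('a, 'b) ring_scheme \<Rightarrow> 'a set \<Rightarrow> ('a, 'a set) module" where
  "quotient_module R I =
     \<lparr>carrier = carrier (R Quot I), mult = mult (R Quot I), one = one (R Quot I),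
      zero = zero (R Quot I), add = add (R Quot I),
      smult = (\<lambda>r. mult (R Quot I) (I +>\<^bsub>R\<^esub> r))\<rparr>"

text \<open>A commutative Artinian ring is Frobenius if its socle is isomorphic, as a module, to the
  quotient by its Jacobson radical. Finiteness of the ring is not required.\<close>

definition frobenius_cring :: "('a, 'b) ring_scheme \<Rightarrow> bool" where
  "frobenius_cring R \<longleftrightarrow> artinian_cring R \<and>
     (\<exists>\<phi> \<in> LinearCombinations.module_hom R (quotient_module R (jacobson_radical R)) (ideal_module R (socle R)).
        bij_betw \<phi> (carrier (quotient_module R (jacobson_radical R)))
          (carrier (ideal_module R (socle R))))"

text \<open>An involutory homomorphism is automatically bijective.\<close>

definition nontrivial_ring_involution :: "('a :: comm_ring_1 \<Rightarrow> 'a) \<Rightarrow> bool" where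
  "nontrivial_ring_involution bar \<longleftrightarrow>
     comm_ring_hom bar \<and> (\<forall>x. bar (bar x) = x) \<and> (\<exists>x. bar x \<noteq> x)"


section \<open>Circulant matrices\<close>

definition circ_shift :: "'a :: semiring_1 \<Rightarrow> 'a vec \<Rightarrow> 'a vec" where
  "circ_shift \<nu> v =
     vec (dim_vec v) (\<lambda>j. if j = 0 then \<nu> * v $ (dim_vec v - 1) else v $ (j - 1))"

definition circ :: "'a :: semiring_1 \<Rightarrow> 'a vec \<Rightarrow> 'a mat" where
  "circ \<nu> v = mat_of_rows (dim_vec v) (map (\<lambda>r. (circ_shift \<nu> ^^ r) v) [0..<dim_vec v])"

definition block_shift :: "'a :: semiring_1 \<Rightarrow> 'a mat list \<Rightarrow> 'a mat list" where
  "block_shift l As = (l \<cdot>\<^sub>m last As) # butlast As"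

text \<open>The blocks in \<open>As\<close> are \<open>n \<times> n\<close>; block row \<open>r\<close> is the \<open>r\<close>-fold shift of \<open>As\<close>.\<close>

definition block_circ :: "nat \<Rightarrow> 'a :: semiring_1 \<Rightarrow> 'a mat list \<Rightarrow> 'a mat" where
  "block_circ n l As = mat (length As * n) (length As * n)
     (\<lambda>(i, j). ((block_shift l ^^ (i div n)) As ! (j div n)) $$ (i mod n, j mod n))"

lemma dim_circ_shift [simp]: "dim_vec (circ_shift \<nu> v) = dim_vec v"
  by (simp add: circ_shift_def)

lemma circ_shift_index:
  "j < dim_vec v \<Longrightarrow>
    circ_shift \<nu> v $ j = (if j = 0 then \<nu> * v $ (dim_vec v - 1) else v $ (j - 1))"
  by (simp add: circ_shift_def)

lemma circ_shift_pow_index: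
  assumes "j < dim_vec v" "r \<le> dim_vec v"
  shows "dim_vec ((circ_shift \<nu> ^^ r) v) = dim_vec v \<and>
    (circ_shift \<nu> ^^ r) v $ j = (if r \<le> j then v $ (j - r) else \<nu> * v $ (dim_vec v + j - r))"
  using assms
proof (induction r arbitrary: j)
  case (Suc r)
  let ?n = "dim_vec v" and ?w = "(circ_shift \<nu> ^^ r) v"
  have d: "dim_vec ?w = ?n" using Suc.IH[of j] Suc.prems by auto
  show ?case
  proof (cases "j = 0")
    case True
    have "?w $ (?n - 1) = v $ (?n - 1 - r)" using Suc.IH[of "?n - 1"] Suc.prems by auto
    with True d Suc.prems show ?thesis by (simp add: circ_shift_index)
  next
    case False
    with d Suc.prems Suc.IH[of "j - 1"] show ?thesis
      by (auto simp: circ_shift_index)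
  qed
qed simp

lemma circ_carrier [simp]: "circ \<nu> v \<in> carrier_mat (dim_vec v) (dim_vec v)"
  by (simp add: circ_def mat_of_rows_def)

lemma circ_index:
  assumes "i < dim_vec v" "j < dim_vec v"
  shows "circ \<nu> v $$ (i, j) = (if i \<le> j then v $ (j - i) else \<nu> * v $ (dim_vec v + j - i))"
  using assms circ_shift_pow_index[of j v i \<nu>] by (simp add: circ_def mat_of_rows_def)

lemma length_block_shift: "As \<noteq> [] \<Longrightarrow> length (block_shift l As) = length As"
  by (simp add: block_shift_def)

lemma block_shift_nth:
  "j < length As \<Longrightarrow>
    block_shift l As ! j = (if j = 0 then l \<cdot>\<^sub>m (As ! (length As - 1)) else As ! (j - 1))"
  by (cases "As = []") (auto simp: block_shift_def last_conv_nth nth_butlast nth_Cons')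

lemma block_shift_pow_nth:
  assumes "j < length As" "r \<le> length As"
  shows "length ((block_shift l ^^ r) As) = length As \<and>
    (block_shift l ^^ r) As ! j =
      (if r \<le> j then As ! (j - r) else l \<cdot>\<^sub>m (As ! (length As + j - r)))"
  using assms
proof (induction r arbitrary: j)
  case (Suc r)
  let ?n = "length As" and ?w = "(block_shift l ^^ r) As"
  have d: "length ?w = ?n" using Suc.IH[of j] Suc.prems by auto
  hence ne: "?w \<noteq> []" using Suc.prems by auto
  show ?case
  proof (cases j)
    case 0
    have "?w ! (?n - 1) = As ! (?n - 1 - r)" using Suc.IH[of "?n - 1"] Suc.prems by auto
    with 0 d ne Suc.prems show ?thesis by (simp add: block_shift_nth length_block_shift)
  next
    case (Suc i)
    with d ne Suc.prems Suc.IH[of i] show ?thesis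
      by (auto simp: block_shift_nth length_block_shift)
  qed
qed simp

definition append_cols :: "'a :: zero mat \<Rightarrow> 'a mat \<Rightarrow> 'a mat" where
  "append_cols A B = four_block_mat A B (0\<^sub>m 0 (dim_col A)) (0\<^sub>m 0 (dim_col B))"


section \<open>The form Theta\<close>

definition Theta :: "'a :: comm_ring_1 vec \<Rightarrow> 'a vec \<Rightarrow> nat \<Rightarrow> 'a \<Rightarrow> 'a" where
  "Theta x y j \<nu> = (let n = dim_vec x in
     (\<Sum>i\<in>{0..<n - j}. x $ ((i + j) mod n) * y $ i) +
     \<nu> * (\<Sum>i\<in>{n - j..<n}. x $ ((i + j) mod n) * y $ i))"

text \<open>For \<open>j = 0\<close> the second sum is empty, so that \<open>\<nu>\<close> is irrelevant.\<close>

definition Theta0 :: "'a :: comm_ring_1 vec \<Rightarrow> 'a vec \<Rightarrow> 'a" where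
  "Theta0 x y = (\<Sum>i\<in>{0..<dim_vec x}. x $ i * y $ i)"

lemma Theta_0: "Theta x y 0 \<nu> = Theta0 x y"
  by (simp add: Theta_def Theta0_def)


section \<open>Codes\<close>

abbreviation code_span :: "nat \<Rightarrow> 'a :: comm_ring_1 vec set \<Rightarrow> 'a vec set" where
  "code_span N \<equiv> LinearCombinations.module.span class_ring (module_vec TYPE('a) N)"

abbreviation code_lin_indpt :: "nat \<Rightarrow> 'a :: comm_ring_1 vec set \<Rightarrow> bool" where
  "code_lin_indpt N B \<equiv>
     \<not> LinearCombinations.module.lin_dep class_ring (module_vec TYPE('a) N) B"

definition code_basis :: "nat \<Rightarrow> 'a :: comm_ring_1 vec set \<Rightarrow> 'a vec set \<Rightarrow> bool" where
  "code_basis N B C \<longleftrightarrow> B \<subseteq> carrier_vec N \<and> code_lin_indpt N B \<and> code_span N B = C"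

text \<open>An \<open>[N, K]\<close>-code: a submodule of \<open>R\<^sup>N\<close> that is free of rank \<open>K\<close>.\<close>

definition linear_code :: "nat \<Rightarrow> nat \<Rightarrow> 'a :: comm_ring_1 vec set \<Rightarrow> bool" where
  "linear_code N K C \<longleftrightarrow>
     LinearCombinations.submodule class_ring C (module_vec TYPE('a) N) \<and>
     (\<exists>B. finite B \<and> card B = K \<and> code_basis N B C)"

definition generator_matrix :: "'a :: comm_ring_1 mat \<Rightarrow> 'a vec set \<Rightarrow> bool" where
  "generator_matrix G C \<longleftrightarrow> distinct (rows G) \<and> code_basis (dim_col G) (set (rows G)) C"

definition hermitian_inner :: "('a :: comm_ring_1 \<Rightarrow> 'a) \<Rightarrow> 'a vec \<Rightarrow> 'a vec \<Rightarrow> 'a" where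
  "hermitian_inner bar x y = x \<bullet> map_vec bar y"

definition hermitian_dual ::
  "('a :: comm_ring_1 \<Rightarrow> 'a) \<Rightarrow> nat \<Rightarrow> 'a vec set \<Rightarrow> 'a vec set" where
  "hermitian_dual bar N C = {x \<in> carrier_vec N. \<forall>y\<in>C. hermitian_inner bar x y = 0}"

definition hermitian_self_dual :: "('a :: comm_ring_1 \<Rightarrow> 'a) \<Rightarrow> nat \<Rightarrow> 'a vec set \<Rightarrow> bool" where
  "hermitian_self_dual bar N C \<longleftrightarrow> C = hermitian_dual bar N C"

end

theory Submission
  imports Defs
begin

text \<open>The code generated by \<open>(I X)\<close> is the graph of \<open>u \<mapsto> u X\<close>, and its Hermitian dual is the set
  of pairs \<open>(- w X\<^sup>*, w)\<close>; since one-sided inverses of square matrices over a commutative ring are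
  two-sided, the code is self-dual iff \<open>X X\<^sup>* = - I\<close>. As \<open>\<lambda>\<close> and \<open>\<mu>\<close> have norm one, the
  entries of \<open>X X\<^sup>*\<close> are, up to units, twisted autocorrelations that depend only on the
  differences \<open>d\<close> and \<open>e\<close> of the block indices and of the indices within a block. Because
  \<open>X X\<^sup>*\<close> is Hermitian, the correlation at \<open>(- d, - e)\<close> vanishes iff the one at \<open>(d, e)\<close> does,
  which is why the ranges up to \<open>\<lfloor>n/2\<rfloor>\<close> and \<open>\<lfloor>k/2\<rfloor>\<close> suffice.\<close>

section \<open>Codes with a systematic generator matrix\<close>

text \<open>Taking determinants, \<open>det B\<close> is inverse to \<open>det A\<close>.
  Multiplying \<open>A * B = I\<close> on the left by the adjugate gives
  \<open>adj A = det A B\<close>, hence \<open>det A (B A) = adj A A = det A I\<close>, and the unit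
  \<open>det A\<close> cancels.\<close>

lemma mat_mult_right_inverse_comm_ring:
  fixes A B :: "'a :: comm_ring_1 mat"
  assumes A: "A \<in> carrier_mat n n" and B: "B \<in> carrier_mat n n" and AB: "A * B = 1\<^sub>m n"
  shows "B * A = 1\<^sub>m n"
proof -
  note adj = adj_mat[OF A]
  have det: "det B * det A = 1"
    using det_mult[OF A B] AB by (simp add: mult.commute)
  have "adj_mat A = adj_mat A * (A * B)" using adj(1) AB by simp
  also have "\<dots> = (adj_mat A * A) * B" using adj(1) A B by (simp add: assoc_mult_mat)
  also have "\<dots> = det A \<cdot>\<^sub>m B" using adj(3) B
    mult_smult_assoc_mat[OF one_carrier_mat B, of "det A"] by simp
  finally have "det A \<cdot>\<^sub>m (B * A) = det A \<cdot>\<^sub>m 1\<^sub>m n"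
    using adj(3) A B by (metis mult_smult_assoc_mat)
  hence "det B \<cdot>\<^sub>m (det A \<cdot>\<^sub>m (B * A)) = det B \<cdot>\<^sub>m (det A \<cdot>\<^sub>m 1\<^sub>m n)" by simp
  hence "(det B * det A) \<cdot>\<^sub>m (B * A) = (det B * det A) \<cdot>\<^sub>m 1\<^sub>m n"
    by (auto simp: mat_eq_iff mult.assoc)
  thus ?thesis by (auto simp: det mat_eq_iff)
qed

section \<open>Row spaces of matrices with distinct rows\<close>

lemma lincomb_rows:
  fixes G :: "'a :: comm_ring_1 mat"
  assumes G: "G \<in> carrier_mat m N" and dist: "distinct (rows G)"
  shows "LinearCombinations.module.lincomb (module_vec TYPE('a) N) f (set (rows G))
    = G\<^sup>T *\<^sub>v vec m (\<lambda>i. f (row G i))"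
proof -
  interpret vec_module "TYPE('a)" N .
  let ?v = "vec m (\<lambda>i. f (row G i))"
  \<comment> \<open>The product with a matrix of columns sums the coefficients over all positions at
    which \<open>l\<close> occurs; distinctness leaves a single position.\<close>
  let ?f = "\<lambda>l. \<Sum>i\<in>{0..<length (rows G)}. if l = rows G ! i then ?v $ i else 0"
  have len: "length (rows G) = m" and nth: "\<And>i. i < m \<Longrightarrow> rows G ! i = row G i"
    using G by auto
  have GT: "mat_of_cols N (rows G) = G\<^sup>T" using G
    by (auto simp: mat_eq_iff mat_of_cols_def rows_def)
  have 1: "G\<^sup>T *\<^sub>v ?v = lincomb ?f (set (rows G))"
    unfolding GT[symmetric]
    by (rule mat_of_cols_mult_as_finsum) (use G len in auto)
  have f: "?f l = f l" if l: "l \<in> set (rows G)" for l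
  proof -
    obtain i where "i < length (rows G)" "rows G ! i = l" using l unfolding in_set_conv_nth by blast
    hence i: "i < m" "l = rows G ! i" using len by simp_all
    have eq: "l = rows G ! j \<longleftrightarrow> i = j" if "j < m" for j
      using nth_eq_iff_index_eq[OF dist, of i j] i that len by simp
    have "?f l = (\<Sum>j\<in>{0..<m}. if i = j then ?v $ j else 0)"
      unfolding len by (intro sum.cong refl) (use eq in auto)
    thus ?thesis using i nth by simp
  qed
  have "lincomb f (set (rows G)) = lincomb ?f (set (rows G))"
    by (rule lincomb_cong) (use set_rows_carrier[OF G] f in auto)
  thus ?thesis using 1 by simp
qed

lemma span_rows:
  fixes G :: "'a :: comm_ring_1 mat"
  assumes G: "G \<in> carrier_mat m N" and dist: "distinct (rows G)"
  shows "code_span N (set (rows G)) = (\<lambda>u. G\<^sup>T *\<^sub>v u) ` carrier_vec m"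
proof -
  interpret vec_module "TYPE('a)" N .
  have car: "set (rows G) \<subseteq> carrier_vec N" using set_rows_carrier[OF G] by auto
  have "span (set (rows G)) = {lincomb f (set (rows G)) | f. True}"
    using finite_span[OF _ car] by simp
  also have "\<dots> = (\<lambda>u. G\<^sup>T *\<^sub>v u) ` carrier_vec m" (is "?L = ?R")
  proof
    show "?L \<subseteq> ?R" using lincomb_rows[OF assms] by auto
    show "?R \<subseteq> ?L"
    proof
      fix x assume "x \<in> ?R"
      then obtain u where u: "u \<in> carrier_vec m" "x = G\<^sup>T *\<^sub>v u" by auto
      have inj: "row G i = row G j \<longleftrightarrow> i = j" if "i < m" "j < m" for i j
        using that dist G by (metis nth_eq_iff_index_eq length_rows nth_rows carrier_matD(1))
      \<comment> \<open>Distinct rows make \<open>i \<mapsto> row G i\<close> injective; its inverse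
        turns any coefficient vector \<open>u\<close> into a coefficient function on the set of
        rows.\<close>
      let ?f = "\<lambda>l. u $ (THE i. i < m \<and> row G i = l)"
      have "vec m (\<lambda>i. ?f (row G i)) = u"
      proof
        fix i assume "i < dim_vec u"
        hence i: "i < m" using u by simp
        hence "(THE j. j < m \<and> row G j = row G i) = i" by (intro the_equality) (auto simp: inj)
        thus "vec m (\<lambda>i. ?f (row G i)) $ i = u $ i" using i by simp
      qed (use u in simp)
      hence "x = lincomb ?f (set (rows G))" using lincomb_rows[OF assms, of ?f] u by simp
      thus "x \<in> ?L" by blast
    qed
  qed
  finally show ?thesis .
qed

text \<open>A dependency \<open>f\<close> with \<open>f v \<noteq> 0\<close> would give a kernel
  vector of \<open>G\<^sup>T\<close> with a nonzero entry at the index of \<open>v\<close>.\<close>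

lemma lin_indpt_rows:
  fixes G :: "'a :: comm_ring_1 mat"
  assumes G: "G \<in> carrier_mat m N" and dist: "distinct (rows G)"
    and inj: "\<And>u. u \<in> carrier_vec m \<Longrightarrow> G\<^sup>T *\<^sub>v u = 0\<^sub>v N \<Longrightarrow> u = 0\<^sub>v m"
  shows "code_lin_indpt N (set (rows G))"
proof
  interpret vec_module "TYPE('a)" N .
  have car: "set (rows G) \<subseteq> carrier_vec N" using set_rows_carrier[OF G] by auto
  assume "lin_dep (set (rows G))"
  then obtain f v where f: "lincomb f (set (rows G)) = 0\<^sub>v N" "v \<in> set (rows G)" "f v \<noteq> 0"
    using finite_lin_dep[OF _ _ car] by auto
  obtain i where i: "i < m" "v = row G i"
    using f(2) G by (metis in_set_conv_nth length_rows nth_rows carrier_matD(1))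
  have "vec m (\<lambda>i. f (row G i)) = 0\<^sub>v m"
    using inj f(1) lincomb_rows[OF G dist] by simp
  hence "f (row G i) = 0" using i by (metis index_vec index_zero_vec(1))
  thus False using f i by simp
qed

section \<open>Codes generated by \<open>(I X)\<close> and their Hermitian duals\<close>

lemma append_cols_carrier:
  "A \<in> carrier_mat m p \<Longrightarrow> B \<in> carrier_mat m q \<Longrightarrow> append_cols A B \<in> carrier_mat m (p + q)"
  by (auto simp: append_cols_def)

lemma transpose_append_cols_mult_vec:
  fixes A B :: "'a :: comm_ring_1 mat"
  assumes "A \<in> carrier_mat m p" "B \<in> carrier_mat m q" "u \<in> carrier_vec m"
  shows "(append_cols A B)\<^sup>T *\<^sub>v u = (A\<^sup>T *\<^sub>v u) @\<^sub>v (B\<^sup>T *\<^sub>v u)"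
proof
  fix i assume "i < dim_vec ((A\<^sup>T *\<^sub>v u) @\<^sub>v (B\<^sup>T *\<^sub>v u))"
  hence i: "i < p + q" using assms by simp
  show "((append_cols A B)\<^sup>T *\<^sub>v u) $ i = ((A\<^sup>T *\<^sub>v u) @\<^sub>v (B\<^sup>T *\<^sub>v u)) $ i"
    using assms i by (auto simp: append_cols_def scalar_prod_def intro!: sum.cong)
qed (use assms in \<open>auto simp: append_cols_def\<close>)

text \<open>The identity block separates the rows and makes \<open>u\<close> the first
  \<open>m\<close> coordinates of \<open>G\<^sup>T *\<^sub>v u\<close>, so the rows are a basis of
  the graph whatever \<open>X\<close> is. The second claim removes the choice of the code.\<close>

lemma systematic_generator_code:
  fixes X :: "'a :: comm_ring_1 mat"
  assumes X: "X \<in> carrier_mat m q" and G: "G = append_cols (1\<^sub>m m) X"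
  defines "C \<equiv> (\<lambda>u. u @\<^sub>v (X\<^sup>T *\<^sub>v u)) ` carrier_vec m"
  shows "linear_code (m + q) m C" "generator_matrix G D \<longleftrightarrow> D = C"
proof -
  interpret vec_module "TYPE('a)" "m + q" .
  have Gc: "G \<in> carrier_mat m (m + q)" using X G append_cols_carrier[OF one_carrier_mat] by simp
  have mult: "G\<^sup>T *\<^sub>v u = u @\<^sub>v (X\<^sup>T *\<^sub>v u)" if "u \<in> carrier_vec m" for u
    using transpose_append_cols_mult_vec[OF one_carrier_mat X that] that G by simp
  have entry: "G $$ (i, j) = (if i = j then 1 else 0)" if "i < m" "j < m" for i j
    using that X G by (simp add: append_cols_def)
  have "i = j" if "i < m" "j < m" "row G i = row G j" for i j
  proof (rule ccontr)
    assume "i \<noteq> j"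
    have "row G i $ i = G $$ (i, i)" "row G j $ i = G $$ (j, i)" using that(1,2) Gc by auto
    hence "G $$ (i, i) = G $$ (j, i)" using that by metis
    thus False using that entry \<open>i \<noteq> j\<close> by simp
  qed
  hence dist: "distinct (rows G)" using Gc by (auto simp: distinct_conv_nth)
  have span: "span (set (rows G)) = C"
    unfolding span_rows[OF Gc dist] C_def using mult by (auto simp: image_def)
  have car: "set (rows G) \<subseteq> carrier_vec (m + q)" using set_rows_carrier[OF Gc] by auto
  have "u = 0\<^sub>v m" if u: "u \<in> carrier_vec m" and 0: "G\<^sup>T *\<^sub>v u = 0\<^sub>v (m + q)" for u
  proof
    fix i assume "i < dim_vec (0\<^sub>v m :: 'a vec)"
    hence i: "i < m" by simp
    have "(u @\<^sub>v (X\<^sup>T *\<^sub>v u)) $ i = 0" using 0 i mult[OF u] by simp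
    thus "u $ i = 0\<^sub>v m $ i" using i u X by simp
  qed (use u in simp)
  hence indpt: "\<not> lin_dep (set (rows G))" by (rule lin_indpt_rows[OF Gc dist])
  have basis: "code_basis (m + q) (set (rows G)) D \<longleftrightarrow> D = C" for D
    unfolding code_basis_def using car indpt span by auto
  show "generator_matrix G D \<longleftrightarrow> D = C"
    unfolding generator_matrix_def using dist basis Gc by simp
  have "submodule class_ring (span (set (rows G))) V" by (rule span_is_submodule[OF car])
  moreover have "card (set (rows G)) = m" using dist Gc by (simp add: distinct_card)
  ultimately show "linear_code (m + q) m C"
    unfolding linear_code_def using basis[of C] span by auto
qed

text \<open>Once \<open>X\<^sup>T\<close> is moved across the product, the pairing of
  \<open>(u, w)\<close> with the codeword of \<open>v\<close> is that of \<open>u + ?Y w\<close>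
  with the conjugate of \<open>v\<close>. It vanishes for all \<open>v\<close> only if
  \<open>u + ?Y w = 0\<close>.\<close>

lemma hermitian_dual_systematic:
  fixes X :: "'a :: comm_ring_1 mat"
  assumes bar: "comm_ring_hom bar" and X: "X \<in> carrier_mat m q"
    and u: "u \<in> carrier_vec m" and w: "w \<in> carrier_vec q"
  shows "u @\<^sub>v w \<in> hermitian_dual bar (m + q) ((\<lambda>u. u @\<^sub>v (X\<^sup>T *\<^sub>v u)) ` carrier_vec m)
    \<longleftrightarrow> u = - (map_mat bar X *\<^sub>v w)"
proof -
  interpret comm_ring_hom bar by fact
  let ?Y = "map_mat bar X"
  have Y: "?Y \<in> carrier_mat m q" using X by simp
  have inner: "hermitian_inner bar (u @\<^sub>v w) (v @\<^sub>v (X\<^sup>T *\<^sub>v v)) = (u + ?Y *\<^sub>v w) \<bullet> map_vec bar v"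
    if v: "v \<in> carrier_vec m" for v
  proof -
    have bv: "map_vec bar v \<in> carrier_vec m" using v by simp
    have "map_vec bar (v @\<^sub>v (X\<^sup>T *\<^sub>v v)) = map_vec bar v @\<^sub>v map_vec bar (X\<^sup>T *\<^sub>v v)"
      by (rule eq_vecI) auto
    also have "map_vec bar (X\<^sup>T *\<^sub>v v) = ?Y\<^sup>T *\<^sub>v map_vec bar v"
      using mult_mat_vec_hom[of "X\<^sup>T" q m v] X v by (simp add: map_mat_transpose)
    finally have "hermitian_inner bar (u @\<^sub>v w) (v @\<^sub>v (X\<^sup>T *\<^sub>v v))
      = u \<bullet> map_vec bar v + w \<bullet> (?Y\<^sup>T *\<^sub>v map_vec bar v)"
      unfolding hermitian_inner_def using u w bv Y
      by (simp add: scalar_prod_append[of _ m _ q])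
    also have "w \<bullet> (?Y\<^sup>T *\<^sub>v map_vec bar v) = (?Y *\<^sub>v w) \<bullet> map_vec bar v"
      using transpose_vec_mult_scalar[OF Y w bv] Y w bv
      by (simp add: comm_scalar_prod[of w q] comm_scalar_prod[of _ m])
    finally show ?thesis using u w bv Y by (simp add: add_scalar_prod_distrib[of _ m])
  qed
  let ?z = "u + ?Y *\<^sub>v w"
  have z: "?z \<in> carrier_vec m" using u w Y by simp
  have "(\<forall>v\<in>carrier_vec m. ?z \<bullet> map_vec bar v = 0) \<longleftrightarrow> ?z = 0\<^sub>v m"
  proof
    assume *: "\<forall>v\<in>carrier_vec m. ?z \<bullet> map_vec bar v = 0"
    show "?z = 0\<^sub>v m"
    proof
      fix i assume "i < dim_vec (0\<^sub>v m :: 'a vec)"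
      hence i: "i < m" by simp
      \<comment> \<open>Unit vectors have entries 0 and 1 and are fixed by \<open>bar\<close>, so
        testing against them reads off the coordinates of \<open>?z\<close>.\<close>
      have "map_vec bar (unit_vec m i) = unit_vec m i" by (auto simp: unit_vec_def)
      moreover have "?z \<bullet> map_vec bar (unit_vec m i) = 0" using * by simp
      ultimately show "?z $ i = 0\<^sub>v m $ i" using scalar_prod_right_unit[OF i, of ?z] i by simp
    qed (use X in simp)
  qed (auto simp: scalar_prod_def)
  moreover have "?z = 0\<^sub>v m \<longleftrightarrow> u = - (?Y *\<^sub>v w)"
    using u X by (auto simp: vec_eq_iff eq_neg_iff_add_eq_0)
  moreover have "u @\<^sub>v w \<in> carrier_vec (m + q)" using u w by simp
  ultimately show ?thesis unfolding hermitian_dual_def using inner by auto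
qed

text \<open>With \<open>Y\<close> the conjugate of \<open>X\<close>, self-orthogonality says that
  \<open>- Y X\<^sup>T\<close> fixes every vector. The reverse inclusion is the same identity with
  the factors exchanged, which holds because \<open>X\<close> is square.\<close>

lemma self_dual_systematic_iff:
  fixes X :: "'a :: comm_ring_1 mat"
  assumes bar: "comm_ring_hom bar" and invol: "\<And>x. bar (bar x) = x" and X: "X \<in> carrier_mat m m"
  shows "hermitian_self_dual bar (m + m) ((\<lambda>u. u @\<^sub>v (X\<^sup>T *\<^sub>v u)) ` carrier_vec m)
    \<longleftrightarrow> X * (map_mat bar X)\<^sup>T = - 1\<^sub>m m"
    (is "hermitian_self_dual _ _ ?C \<longleftrightarrow> _")
proof -
  interpret comm_ring_hom bar by fact
  let ?Y = "map_mat bar X"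
  let ?D = "hermitian_dual bar (m + m) ?C"
  note dual = hermitian_dual_systematic[OF bar X]
  have Y: "?Y \<in> carrier_mat m m" and XT: "X\<^sup>T \<in> carrier_mat m m" using X by auto
  \<comment> \<open>Entrywise conjugation carries one product to the other, fixes
    \<open>- I\<close>, and is its own inverse.\<close>
  have conj: "X * ?Y\<^sup>T = - 1\<^sub>m m \<longleftrightarrow> ?Y * X\<^sup>T = - 1\<^sub>m m"
  proof -
    have bb: "map_mat bar (map_mat bar A) = A" for A using invol by (auto simp: mat_eq_iff)
    have b1: "map_mat bar (- 1\<^sub>m m) = - 1\<^sub>m m" by (auto simp: mat_eq_iff hom_uminus)
    have 1: "map_mat bar (X * ?Y\<^sup>T) = ?Y * X\<^sup>T"
      using mat_hom_mult[OF X, of "?Y\<^sup>T" m] Y bb by (simp add: map_mat_transpose)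
    show ?thesis using 1 b1 bb by metis
  qed
  have neg: "- (?Y *\<^sub>v (X\<^sup>T *\<^sub>v u)) = (- (?Y * X\<^sup>T)) *\<^sub>v u" if "u \<in> carrier_vec m" for u
    using that X Y by (simp add: assoc_mult_mat_vec[OF Y XT])
  have "?C = ?D \<longleftrightarrow> ?Y * X\<^sup>T = - 1\<^sub>m m"
  proof
    assume eq: "?C = ?D"
    have id: "(- (?Y * X\<^sup>T)) *\<^sub>v u = u" if u: "u \<in> carrier_vec m" for u
    proof -
      have "u @\<^sub>v (X\<^sup>T *\<^sub>v u) \<in> ?D" using eq u by auto
      hence "u = - (?Y *\<^sub>v (X\<^sup>T *\<^sub>v u))"
        using dual[OF u mult_mat_vec_carrier[OF XT u]] by simp
      thus ?thesis using neg[OF u] by metis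
    qed
    \<comment> \<open>A matrix that fixes all vectors fixes the unit vectors, whose images are its
      columns.\<close>
    have "- (?Y * X\<^sup>T) = 1\<^sub>m m"
    proof (rule eq_matI)
      fix i j assume "i < dim_row (1\<^sub>m m :: 'a mat)" "j < dim_col (1\<^sub>m m :: 'a mat)"
      hence ij: "i < m" "j < m" by auto
      let ?A = "- (?Y * X\<^sup>T)"
      have A: "?A \<in> carrier_mat m m" using XT Y by simp
      have "?A $$ (i, j) = row ?A i $ j" using ij A by (metis carrier_matD index_row(1))
      also have "\<dots> = row ?A i \<bullet> unit_vec m j" using ij by (metis scalar_prod_right_unit)
      also have "\<dots> = (?A *\<^sub>v unit_vec m j) $ i" using ij A
        by (metis carrier_matD(1) index_mult_mat_vec)
      also have "\<dots> = (1\<^sub>m m) $$ (i, j)" using id[of "unit_vec m j"] ij by (simp add: unit_vec_def)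
      finally show "?A $$ (i, j) = (1\<^sub>m m) $$ (i, j)" .
    qed (use X in auto)
    thus "?Y * X\<^sup>T = - 1\<^sub>m m" by (metis uminus_uminus_mat)
  next
    assume eq: "?Y * X\<^sup>T = - 1\<^sub>m m"
    hence inv: "(- ?Y) * X\<^sup>T = 1\<^sub>m m" using X by simp
    have nY: "- ?Y \<in> carrier_mat m m" using Y by simp
    note inv' = mat_mult_right_inverse_comm_ring[OF nY XT inv]
    show "?C = ?D"
    proof
      show "?C \<subseteq> ?D"
      proof
        fix x assume "x \<in> ?C"
        then obtain u where u: "u \<in> carrier_vec m" "x = u @\<^sub>v (X\<^sup>T *\<^sub>v u)" by auto
        thus "x \<in> ?D" using dual[of u "X\<^sup>T *\<^sub>v u"] neg XT eq by simp
      qed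
      show "?D \<subseteq> ?C"
      proof
        fix x assume x: "x \<in> ?D"
        hence xc: "x \<in> carrier_vec (m + m)" by (simp add: hermitian_dual_def)
        define u w where "u = vec_first x m" and "w = vec_last x m"
        have uw: "u \<in> carrier_vec m" "w \<in> carrier_vec m" "x = u @\<^sub>v w"
          using vec_first_last_append[OF xc] by (auto simp: u_def w_def)
        hence "u = - (?Y *\<^sub>v w)" using dual x by simp
        also have "\<dots> = (- ?Y) *\<^sub>v w" using uw Y by simp
        finally have "X\<^sup>T *\<^sub>v u = X\<^sup>T * (- ?Y) *\<^sub>v w"
          by (simp only: assoc_mult_mat_vec[OF XT nY uw(2)])
        hence "X\<^sup>T *\<^sub>v u = w" unfolding inv' using uw by simp
        thus "x \<in> ?C" using uw by auto
      qed
    qed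
  qed
  thus ?thesis unfolding hermitian_self_dual_def conj .
qed

section \<open>Twisted correlations\<close>

text \<open>The twist of a \<open>\<nu>\<close>-circulant at position \<open>(i, j)\<close>, present
  only below the diagonal. Keeping it apart from the cyclic index lets blocks and entries be treated
  alike.\<close>

definition wrap :: "'a :: semiring_1 \<Rightarrow> nat \<Rightarrow> nat \<Rightarrow> 'a" where
  "wrap \<nu> i j = (if j < i then \<nu> else 1)"

text \<open>Subtraction on \<open>nat\<close> truncates, so \<open>N\<close> is added first; the
  case form replaces \<open>mod\<close> by linear arithmetic.\<close>

lemma mod_diff_index:
  "s < N \<Longrightarrow> r < N \<Longrightarrow> (s + N - r) mod N = (if r \<le> s then s - r else s + N - r)" for N :: nat
  by (simp add: mod_if)

lemma mod_add_index:
  "s < N \<Longrightarrow> r < N \<Longrightarrow> (s + r) mod N = (if s + r < N then s + r else s + r - N)" for N :: nat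
  by (simp add: mod_if)

lemma circ_index_mod:
  assumes "v \<in> carrier_vec n" "i < n" "j < n"
  shows "circ \<nu> v $$ (i, j) = wrap \<nu> i j * v $ ((j + n - i) mod n)"
  using assms by (auto simp: circ_index wrap_def mod_diff_index add.commute)

lemma block_index_less: "i < k \<Longrightarrow> p < n \<Longrightarrow> i * n + p < k * (n :: nat)"
proof -
  assume "i < k" "p < n"
  hence "i * n + p < Suc i * n" by simp
  also have "\<dots> \<le> k * n" using \<open>i < k\<close> by (intro mult_right_mono) auto
  finally show ?thesis .
qed

lemma block_circ_index:
  assumes "\<And>i. i < k \<Longrightarrow> A i \<in> carrier_mat n n" "r < k" "s < k" "p < n" "q < n"
  shows "block_circ n l (map A [0..<k]) $$ (r * n + p, s * n + q)
    = wrap l r s * A ((s + k - r) mod k) $$ (p, q)"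
proof -
  have "(s + k - r) mod k < k" using assms by simp
  hence A: "A ((s + k - r) mod k) \<in> carrier_mat n n" by (rule assms(1))
  let ?B = "(block_shift l ^^ r) (map A [0..<k])"
  have "?B ! s = (if r \<le> s then A (s - r) else l \<cdot>\<^sub>m A (s + k - r))"
    using block_shift_pow_nth[of s "map A [0..<k]" r l] assms(2,3)
    by (cases "r \<le> s") (simp_all add: add.commute)
  moreover have "block_circ n l (map A [0..<k]) $$ (r * n + p, s * n + q) = ?B ! s $$ (p, q)"
    using assms(2-5) by (simp add: block_circ_def block_index_less)
  ultimately show ?thesis
    using A assms(2-5) by (cases "r \<le> s") (simp_all add: wrap_def mod_diff_index)
qed

lemma sum_lessThan_mult:
  fixes f :: "nat \<Rightarrow> 'b :: comm_monoid_add"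
  shows "(\<Sum>l<k * n. f l) = (\<Sum>s<k. \<Sum>q<n. f (s * n + q))"
proof -
  have "(\<Sum>l<k * n. f l) = (\<Sum>s<k. sum f {s * n..<s * n + n})" by (rule sum.nat_group[symmetric])
  also have "\<dots> = (\<Sum>s<k. \<Sum>q<n. f (s * n + q))"
  proof (rule sum.cong[OF refl])
    fix s
    show "sum f {s * n..<s * n + n} = (\<Sum>q<n. f (s * n + q))"
      by (rule sum.reindex_bij_witness[of _ "\<lambda>q. s * n + q" "\<lambda>l. l - s * n"]) auto
  qed
  finally show ?thesis .
qed

text \<open>Reindexing by \<open>i = s - r'\<close>: up to the unit \<open>wrap \<nu> r r'\<close>, the sum depends only on the
  residue of \<open>r' - r\<close>, because \<open>\<nu> * \<nu>' = 1\<close> makes the summand periodic when \<open>s\<close> is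
  continued past \<open>N\<close>.\<close>

lemma wrap_sum_shift:
  fixes h :: "nat \<Rightarrow> nat \<Rightarrow> 'a :: comm_ring_1"
  assumes "r < N" "r' < N" and unit: "\<nu> * \<nu>' = 1"
  defines "d \<equiv> (r' + N - r) mod N"
  shows "(\<Sum>s<N. wrap \<nu> r s * wrap \<nu>' r' s * h ((s + N - r) mod N) ((s + N - r') mod N))
    = wrap \<nu> r r' * ((\<Sum>i\<in>{0..<N - d}. h ((i + d) mod N) i) +
        \<nu>' * (\<Sum>i\<in>{N - d..<N}. h ((i + d) mod N) i))"
proof -
  have d: "d = (if r \<le> r' then r' - r else r' + N - r)"
    unfolding d_def using mod_diff_index[OF assms(2,1)] .
  have dN: "d < N" using assms by (simp add: d_def)
  have "(\<Sum>s<N. wrap \<nu> r s * wrap \<nu>' r' s * h ((s + N - r) mod N) ((s + N - r') mod N))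
    = (\<Sum>i<N. wrap \<nu> r r' * ((if i + d < N then 1 else \<nu>') * h ((i + d) mod N) i))"
  proof (rule sum.reindex_bij_witness[of _ "\<lambda>i. (i + r') mod N" "\<lambda>s. (s + N - r') mod N"])
    fix s assume "s \<in> {..<N}"
    hence s: "s < N" by simp
    define i where "i = (s + N - r') mod N"
    have i: "i = (if r' \<le> s then s - r' else s + N - r')"
      unfolding i_def by (rule mod_diff_index[OF s assms(2)])
    have iN: "i < N" using s by (simp add: i_def)
    have 1: "(i + d) mod N = (s + N - r) mod N"
      unfolding mod_add_index[OF iN dN] mod_diff_index[OF s assms(1)] unfolding i d
      using assms(1,2) s by (auto split: if_splits)
    \<comment> \<open>All orders of \<open>r\<close>, \<open>r'\<close> and \<open>s\<close> are
      compared. The relation \<open>\<nu> * \<nu>' = 1\<close> enters for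
      \<open>s < r \<le> r'\<close>, where only the right side carries both factors, and for
      \<open>r' < r \<le> s\<close>, where only the left side does.\<close>
    have 2: "wrap \<nu> r r' * (if i + d < N then 1 else \<nu>') = wrap \<nu> r s * wrap \<nu>' r' s"
      using assms(1,2) s unit by (auto simp: i d wrap_def)
    show "wrap \<nu> r r' * ((if (s + N - r') mod N + d < N then 1 else \<nu>') *
        h (((s + N - r') mod N + d) mod N) ((s + N - r') mod N))
      = wrap \<nu> r s * wrap \<nu>' r' s * h ((s + N - r) mod N) ((s + N - r') mod N)"
      unfolding i_def[symmetric] 1 2[symmetric] by (simp add: mult.assoc)
    show "((s + N - r') mod N + r') mod N = s"
      unfolding i_def[symmetric] mod_add_index[OF iN assms(2)] unfolding i using assms(1,2) s by auto
    show "(s + N - r') mod N \<in> {..<N}" using s by simp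
  next
    fix i assume "i \<in> {..<N}"
    hence i: "i < N" by simp
    hence j: "(i + r') mod N < N" by simp
    show "((i + r') mod N + N - r') mod N = i"
      unfolding mod_diff_index[OF j assms(2)] mod_add_index[OF i assms(2)] using i assms(2) by auto
    show "(i + r') mod N \<in> {..<N}" using j by simp
  qed
  also have "\<dots> = wrap \<nu> r r' * (\<Sum>i<N. (if i + d < N then 1 else \<nu>') * h ((i + d) mod N) i)"
    by (simp add: sum_distrib_left)
  also have "(\<Sum>i<N. (if i + d < N then 1 else \<nu>') * h ((i + d) mod N) i)
    = (\<Sum>i\<in>{0..<N - d}. (if i + d < N then 1 else \<nu>') * h ((i + d) mod N) i)
      + (\<Sum>i\<in>{N - d..<N}. (if i + d < N then 1 else \<nu>') * h ((i + d) mod N) i)"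
    unfolding lessThan_atLeast0 by (rule sum.atLeastLessThan_concat[symmetric]) auto
  also have "(\<Sum>i\<in>{0..<N - d}. (if i + d < N then 1 else \<nu>') * h ((i + d) mod N) i)
    = (\<Sum>i\<in>{0..<N - d}. h ((i + d) mod N) i)"
    by (rule sum.cong) auto
  also have "(\<Sum>i\<in>{N - d..<N}. (if i + d < N then 1 else \<nu>') * h ((i + d) mod N) i)
    = \<nu>' * (\<Sum>i\<in>{N - d..<N}. h ((i + d) mod N) i)"
    unfolding sum_distrib_left by (rule sum.cong) auto
  finally show ?thesis .
qed

section \<open>The Gram matrix of a block circulant matrix with circulant blocks\<close>

locale double_circulant =
  fixes bar :: "'a :: comm_ring_1 \<Rightarrow> 'a" and k n :: nat and lam mu :: 'a
    and a :: "nat \<Rightarrow> 'a vec"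
  assumes hom: "comm_ring_hom bar" and invol: "bar (bar x) = x"
    and k: "k \<ge> 1" and n: "n \<ge> 1"
    and lam: "lam * bar lam = 1" and mu: "mu * bar mu = 1"
    and a: "i < k \<Longrightarrow> a i \<in> carrier_vec n"
begin

sublocale comm_ring_hom bar by (rule hom)

definition X :: "'a mat" where
  "X = block_circ n lam (map (\<lambda>i. circ mu (a i)) [0..<k])"

text \<open>One quantity for all three conditions: \<open>d = 0\<close> empties the second sum and
  gives (i), \<open>e = 0\<close> gives (ii), and the remaining pairs give (iii).\<close>

definition corr :: "nat \<Rightarrow> nat \<Rightarrow> 'a" where
  "corr d e = (\<Sum>i\<in>{0..<k - d}. Theta (a ((i + d) mod k)) (map_vec bar (a i)) e (bar mu)) +
     bar lam * (\<Sum>i\<in>{k - d..<k}. Theta (a ((i + d) mod k)) (map_vec bar (a i)) e (bar mu))"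

definition gram :: "'a mat" where
  "gram = X * (map_mat bar X)\<^sup>T"

lemma X_carrier: "X \<in> carrier_mat (k * n) (k * n)"
  by (simp add: X_def block_circ_def)

lemma gram_carrier: "gram \<in> carrier_mat (k * n) (k * n)"
  using X_carrier by (simp add: gram_def)

lemma X_index:
  assumes "r < k" "s < k" "p < n" "q < n"
  shows "X $$ (r * n + p, s * n + q)
    = wrap lam r s * (wrap mu p q * a ((s + k - r) mod k) $ ((q + n - p) mod n))"
proof -
  have "circ mu (a i) \<in> carrier_mat n n" if "i < k" for i
    using circ_carrier[of mu "a i"] a[OF that] by simp
  moreover have "(s + k - r) mod k < k" using assms by simp
  ultimately show ?thesis
    unfolding X_def using assms by (simp add: block_circ_index circ_index_mod[OF a])
qed

lemma bar_wrap: "bar (wrap \<nu> i j) = wrap (bar \<nu>) i j"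
  by (simp add: wrap_def)

text \<open>The column index splits into a block index \<open>s\<close> and an inner index
  \<open>q\<close>. Shifting the sum over \<open>q\<close> with twist \<open>mu\<close> produces
  \<open>Theta\<close>; shifting the sum over \<open>s\<close> with twist \<open>lam\<close> then
  produces \<open>corr\<close>.\<close>

lemma gram_index:
  assumes "r < k" "r' < k" "p < n" "p' < n"
  shows "gram $$ (r * n + p, r' * n + p')
    = wrap lam r r' * wrap mu p p' * corr ((r' + k - r) mod k) ((p' + n - p) mod n)"
proof -
  let ?e = "(p' + n - p) mod n"
  let ?H = "\<lambda>i i'. Theta (a i) (map_vec bar (a i')) ?e (bar mu)"
  have inner: "(\<Sum>q<n. wrap mu p q * wrap (bar mu) p' q *
      (a i $ ((q + n - p) mod n) * bar (a i' $ ((q + n - p') mod n)))) = wrap mu p p' * ?H i i'"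
    if "i < k" "i' < k" for i i'
  proof -
    have "?H i i' = (\<Sum>q\<in>{0..<n - ?e}. a i $ ((q + ?e) mod n) * bar (a i' $ q)) +
        bar mu * (\<Sum>q\<in>{n - ?e..<n}. a i $ ((q + ?e) mod n) * bar (a i' $ q))"
      using a[OF that(1)] a[OF that(2)] by (auto simp: Theta_def
        intro!: arg_cong2[of _ _ _ _ "(+)"] arg_cong2[of _ _ _ _ "(*)"] sum.cong)
    thus ?thesis
      using wrap_sum_shift[OF assms(3,4) mu, of "\<lambda>x y. a i $ x * bar (a i' $ y)"] by simp
  qed
  have "gram $$ (r * n + p, r' * n + p')
    = (\<Sum>l<k * n. X $$ (r * n + p, l) * bar (X $$ (r' * n + p', l)))"
    using X_carrier assms by (auto simp: gram_def scalar_prod_def block_index_less lessThan_atLeast0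
      intro!: sum.cong)
  also have "\<dots> = (\<Sum>s<k. \<Sum>q<n. X $$ (r * n + p, s * n + q) * bar (X $$ (r' * n + p', s * n + q)))"
    by (rule sum_lessThan_mult)
  also have "\<dots> = (\<Sum>s<k. wrap lam r s * wrap (bar lam) r' s *
      (wrap mu p p' * ?H ((s + k - r) mod k) ((s + k - r') mod k)))"
  proof (rule sum.cong)
    fix s assume "s \<in> {..<k}"
    hence s: "s < k" by simp
    have "(\<Sum>q<n. X $$ (r * n + p, s * n + q) * bar (X $$ (r' * n + p', s * n + q)))
      = (\<Sum>q<n. wrap lam r s * wrap (bar lam) r' s * (wrap mu p q * wrap (bar mu) p' q *
          (a ((s + k - r) mod k) $ ((q + n - p) mod n) *
           bar (a ((s + k - r') mod k) $ ((q + n - p') mod n)))))"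
    proof (rule sum.cong[OF refl])
      fix q assume "q \<in> {..<n}"
      hence q: "q < n" by simp
      show "X $$ (r * n + p, s * n + q) * bar (X $$ (r' * n + p', s * n + q))
        = wrap lam r s * wrap (bar lam) r' s * (wrap mu p q * wrap (bar mu) p' q *
          (a ((s + k - r) mod k) $ ((q + n - p) mod n) *
           bar (a ((s + k - r') mod k) $ ((q + n - p') mod n))))"
        unfolding X_index[OF assms(1) s assms(3) q] X_index[OF assms(2) s assms(4) q]
          hom_mult bar_wrap by (simp only: mult_ac)
    qed
    also have "\<dots> = wrap lam r s * wrap (bar lam) r' s *
        (wrap mu p p' * ?H ((s + k - r) mod k) ((s + k - r') mod k))"
      unfolding sum_distrib_left[symmetric] using s by (subst inner) auto
    finally show "(\<Sum>q<n. X $$ (r * n + p, s * n + q) * bar (X $$ (r' * n + p', s * n + q)))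
      = wrap lam r s * wrap (bar lam) r' s *
        (wrap mu p p' * ?H ((s + k - r) mod k) ((s + k - r') mod k))" .
  qed simp
  also have "\<dots> = wrap mu p p' * (\<Sum>s<k. wrap lam r s * wrap (bar lam) r' s *
      ?H ((s + k - r) mod k) ((s + k - r') mod k))"
    unfolding sum_distrib_left by (rule sum.cong) (simp_all add: ac_simps)
  also have "\<dots> = wrap mu p p' * (wrap lam r r' * corr ((r' + k - r) mod k) ?e)"
    unfolding corr_def by (subst wrap_sum_shift[OF assms(1,2) lam, of ?H]) simp
  finally show ?thesis by (simp add: ac_simps)
qed

section \<open>Symmetry of the correlations and reduction to half ranges\<close>

lemma gram_hermitian:
  assumes "i < k * n" "j < k * n"
  shows "bar (gram $$ (i, j)) = gram $$ (j, i)"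
  using assms X_carrier
  by (auto simp: gram_def scalar_prod_def hom_sum hom_mult invol mult.commute intro!: sum.cong)

text \<open>The entries of \<open>gram\<close> at \<open>(0, d * n + e)\<close> and
  \<open>(d * n + e, 0)\<close> are conjugate. The first is \<open>corr d e\<close>, the second is
  the correlation at the negated residues times the unit \<open>?w\<close>.\<close>

lemma corr_neg_eq_0_iff:
  assumes "d < k" "e < n"
  shows "corr ((k - d) mod k) ((n - e) mod n) = 0 \<longleftrightarrow> corr d e = 0"
proof -
  let ?w = "wrap lam d 0 * wrap mu e 0"
  have 1: "gram $$ (0, d * n + e) = corr d e"
    using gram_index[of 0 d 0 e] assms k n by (simp add: wrap_def)
  have 2: "gram $$ (d * n + e, 0) = ?w * corr ((k - d) mod k) ((n - e) mod n)"
    using gram_index[of d 0 e 0] assms k n by simp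
  have 3: "bar (corr d e) = ?w * corr ((k - d) mod k) ((n - e) mod n)"
    using gram_hermitian[of 0 "d * n + e"] 1 2 assms k n by (simp add: block_index_less)
  \<comment> \<open>Each factor of \<open>?w\<close> is 1 or one of \<open>lam\<close> and
    \<open>mu\<close>, which have norm one.\<close>
  have "bar ?w * ?w = 1"
    using lam mu by (auto simp: wrap_def hom_mult ac_simps)
  hence "corr ((k - d) mod k) ((n - e) mod n) = bar ?w * bar (corr d e)"
    unfolding 3 mult.assoc[symmetric] by simp
  thus ?thesis using 3 invol by (metis hom_zero mult_zero_right)
qed

text \<open>The first row of \<open>gram\<close> lists all correlations. Conversely every entry is a
  multiple of the correlation at the two residue differences; both are 0 exactly on the diagonal,
  where the twists are 1.\<close>

lemma gram_eq_iff:
  "gram = - 1\<^sub>m (k * n) \<longleftrightarrow>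
    corr 0 0 = - 1 \<and> (\<forall>d<k. \<forall>e<n. (d, e) \<noteq> (0, 0) \<longrightarrow> corr d e = 0)"
proof
  assume g: "gram = - 1\<^sub>m (k * n)"
  have "corr d e = (if (d, e) = (0, 0) then - 1 else 0)" if "d < k" "e < n" for d e
  proof -
    have "corr d e = gram $$ (0, d * n + e)"
      using gram_index[of 0 d 0 e] that k n by (simp add: wrap_def)
    thus ?thesis unfolding g using that k n block_index_less[OF that] by auto
  qed
  thus "corr 0 0 = - 1 \<and> (\<forall>d<k. \<forall>e<n. (d, e) \<noteq> (0, 0) \<longrightarrow> corr d e = 0)" using k n by auto
next
  assume c: "corr 0 0 = - 1 \<and> (\<forall>d<k. \<forall>e<n. (d, e) \<noteq> (0, 0) \<longrightarrow> corr d e = 0)"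
  show "gram = - 1\<^sub>m (k * n)"
  proof (rule eq_matI)
    fix i j assume "i < dim_row (- 1\<^sub>m (k * n) :: 'a mat)" "j < dim_col (- 1\<^sub>m (k * n) :: 'a mat)"
    hence ij: "i < k * n" "j < k * n" by auto
    define r p r' p' where defs: "r = i div n" "p = i mod n" "r' = j div n" "p' = j mod n"
    have rp: "r < k" "p < n" "r' < k" "p' < n" "i = r * n + p" "j = r' * n + p'"
      using ij n by (auto simp: defs less_mult_imp_div_less)
    have mod0: "(y + N - x) mod N = 0 \<longleftrightarrow> x = y" if "x < N" "y < N" for x y N :: nat
      using that by (auto simp: mod_if)
    have eq: "i = j \<longleftrightarrow> r = r' \<and> p = p'" by (metis rp(5,6) defs)
    have "gram $$ (i, j) = wrap lam r r' * wrap mu p p' *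
        corr ((r' + k - r) mod k) ((p' + n - p) mod n)"
      using gram_index rp by simp
    also have "\<dots> = (if i = j then - 1 else 0)"
    proof (cases "i = j")
      case True
      thus ?thesis using c eq by (simp add: wrap_def)
    next
      case False
      hence "((r' + k - r) mod k, (p' + n - p) mod n) \<noteq> (0, 0)" using eq mod0 rp by auto
      moreover have "(r' + k - r) mod k < k" "(p' + n - p) mod n < n" using k n by auto
      ultimately have "corr ((r' + k - r) mod k) ((p' + n - p) mod n) = 0" using c by blast
      thus ?thesis using False by simp
    qed
    finally show "gram $$ (i, j) = (- 1\<^sub>m (k * n)) $$ (i, j)" using ij by simp
  qed (use gram_carrier in auto)
qed

text \<open>An index or its negative lies in the lower half. Negation acts on \<open>d\<close> and
  \<open>e\<close> together, so when both are positive only \<open>e\<close> can be halved while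
  \<open>j\<close> still runs up to \<open>k - 1\<close>.\<close>

lemma gram_eq_iff_half:
  "gram = - 1\<^sub>m (k * n) \<longleftrightarrow>
    (corr 0 0 = - 1 \<and> (\<forall>t\<in>{1..n div 2}. corr 0 t = 0)) \<and>
    (\<forall>j\<in>{1..k div 2}. corr j 0 = 0) \<and>
    (\<forall>j\<in>{1..k - 1}. \<forall>t\<in>{1..n div 2}. corr j t = 0)"
    (is "_ \<longleftrightarrow> (?c0 \<and> ?ci) \<and> ?cii \<and> ?ciii")
  unfolding gram_eq_iff
proof (intro iffI conjI ballI allI impI)
  assume c: "(?c0 \<and> ?ci) \<and> ?cii \<and> ?ciii"
  thus ?c0 by simp
  fix d e assume de: "d < k" "e < n" "(d, e) \<noteq> (0, 0)"
  \<comment> \<open>The residue of a negated index is 0, not \<open>k\<close> or \<open>n\<close>,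
    when the index is 0; hence three forms of the symmetry.\<close>
  have neg: "corr (k - d) (n - e) = 0 \<Longrightarrow> corr d e = 0" if "d > 0" "e > 0"
    using corr_neg_eq_0_iff[of d e] de that by simp
  have neg0: "corr 0 (n - e) = 0 \<Longrightarrow> corr d e = 0" if "d = 0" "e > 0"
    using corr_neg_eq_0_iff[of d e] de that by simp
  have neg1: "corr (k - d) 0 = 0 \<Longrightarrow> corr d e = 0" if "d > 0" "e = 0"
    using corr_neg_eq_0_iff[of d e] de that by simp
  have half: "x \<in> {1..N div 2} \<or> N - x \<in> {1..N div 2}" if "0 < x" "x < N" for x N :: nat
    using that by auto
  consider "d = 0" "e > 0" | "d > 0" "e = 0" | "d > 0" "e > 0" using de by fastforce
  thus "corr d e = 0"
  proof cases
    case 1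
    thus ?thesis using half[of e n] de c neg0 by blast
  next
    case 2
    thus ?thesis using half[of d k] de c neg1 by blast
  next
    case 3
    have "d \<in> {1..k - 1}" "k - d \<in> {1..k - 1}" using 3 de by auto
    thus ?thesis using half[of e n] 3 de c neg by blast
  qed
\<comment> \<open>Left are the restrictions to half ranges: \<open>k\<close> and \<open>n\<close>
  are positive, so \<open>k div 2 < k\<close> and \<open>n div 2 < n\<close>.\<close>
qed (use k n in auto)

end

theorem theorem2:
  fixes bar :: "'a :: comm_ring_1 \<Rightarrow> 'a"
    and k n :: nat
    and lam mu :: 'a
    and a :: "nat \<Rightarrow> 'a vec"
    and X G :: "'a mat"
  assumes "frobenius_cring (class_ring :: 'a ring)"
    and "nontrivial_ring_involution bar"
    and "k \<ge> 1" and "n \<ge> 1"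
    and "lam * bar lam = 1" and "mu * bar mu = 1"
    and "\<And>i. i < k \<Longrightarrow> a i \<in> carrier_vec n"
    and X: "X = block_circ n lam (map (\<lambda>i. circ mu (a i)) [0..<k])"
    and G: "G = append_cols (1\<^sub>m (k * n)) X"
  shows "(\<exists>C. linear_code (2 * k * n) (k * n) C \<and> generator_matrix G C \<and>
              hermitian_self_dual bar (2 * k * n) C)
    \<longleftrightarrow>
      ((\<Sum>i\<in>{0..<k}. Theta (a i) (map_vec bar (a i)) 0 (bar mu)) = - 1 \<and>
       (\<forall>t\<in>{1..n div 2}. (\<Sum>i\<in>{0..<k}. Theta (a i) (map_vec bar (a i)) t (bar mu)) = 0))
      \<and>
      (\<forall>j\<in>{1..k div 2}.
         (\<Sum>i\<in>{0..<k - j}. Theta0 (a ((i + j) mod k)) (map_vec bar (a i))) +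
         bar lam * (\<Sum>i\<in>{k - j..<k}. Theta0 (a ((i + j) mod k)) (map_vec bar (a i))) = 0)
      \<and>
      (\<forall>j\<in>{1..k - 1}. \<forall>t\<in>{1..n div 2}.
         (\<Sum>i\<in>{0..<k - j}. Theta (a ((i + j) mod k)) (map_vec bar (a i)) t (bar mu)) +
         bar lam *
         (\<Sum>i\<in>{k - j..<k}. Theta (a ((i + j) mod k)) (map_vec bar (a i)) t (bar mu)) = 0)"
  proof -
  have bar: "comm_ring_hom bar" and invol: "\<And>x. bar (bar x) = x"
    using assms(2) by (auto simp: nontrivial_ring_involution_def)
  interpret D: double_circulant bar k n lam mu a
    using assms bar invol by (auto simp: double_circulant_def)
  have XD: "X = D.X" unfolding X D.X_def ..
  have Xc: "X \<in> carrier_mat (k * n) (k * n)" using D.X_carrier XD by simp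
  have len: "2 * k * n = k * n + k * n" by simp
  let ?C = "(\<lambda>u. u @\<^sub>v (X\<^sup>T *\<^sub>v u)) ` carrier_vec (k * n)"
  have corr0: "D.corr 0 t = (\<Sum>i\<in>{0..<k}. Theta (a i) (map_vec bar (a i)) t (bar mu))" for t
    unfolding D.corr_def by simp
  have corrj: "D.corr j 0 =
    (\<Sum>i\<in>{0..<k - j}. Theta0 (a ((i + j) mod k)) (map_vec bar (a i))) +
      bar lam * (\<Sum>i\<in>{k - j..<k}. Theta0 (a ((i + j) mod k)) (map_vec bar (a i)))" for j
    unfolding D.corr_def Theta_0 ..
  \<comment> \<open>The only code generated by \<open>G\<close> is \<open>?C\<close>, so the
    existential collapses.\<close>
  have "(\<exists>C. linear_code (2 * k * n) (k * n) C \<and> generator_matrix G C \<and>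
      hermitian_self_dual bar (2 * k * n) C) \<longleftrightarrow> hermitian_self_dual bar (2 * k * n) ?C"
    unfolding len using systematic_generator_code[OF Xc G] by auto
  also have "\<dots> \<longleftrightarrow> D.gram = - 1\<^sub>m (k * n)"
    unfolding len D.gram_def XD[symmetric] by (rule self_dual_systematic_iff[OF bar invol Xc])
  finally show ?thesis
    \<comment> \<open>The order matters: \<open>corr 0 0\<close> matches both \<open>corr0\<close>
      and \<open>corrj\<close>, and (i) is stated with \<open>Theta\<close>, not
      \<open>Theta0\<close>.\<close>
    unfolding D.gram_eq_iff_half unfolding corr0 unfolding corrj unfolding D.corr_def .
qed

end
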